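(* Let $n\ge 1$ and let $\alpha=(\alpha_S)_{\emptyset\ne S\subseteq[n]}$ be real numbers. Suppose that every $\pi\in\Psi_n$ satisfies $\sum_{\emptyset\ne S\subseteq[n]}\alpha_S\pi_S\le 0$. Then this linear inequality is an NC inequality or a positive linear combination of NC inequalities; that is, there are finitely many pairs $(\mathcal{A}^{(r)},\mathcal{B}^{(r)})$, $r=1,\dots,R$, with $\mathcal{A}^{(r)}$ covering $\mathcal{B}^{(r)}$, and reals $\lambda_r>0$ such that for every nonempty $S\subseteq[n]$, $$\alpha_S=\sum_{r=1}^R\lambda_r\Big(\#\{B\in\mathcal{B}^{(r)}: B=S\}-\#\{A\in\mathcal{A}^{(r)}: A=S\}\Big),$$ where multiplicities in the families are counted.
   Context: An object is a bounded compact subset $T\subseteq\mathbb{R}^n_+$. For nonempty $S\subseteq[n]=\{1,\dots,n\}$, $T_S$ is the orthogonal projection of $T$ onto the coordinate subspace spanned by the standard basis vectors $v_i$, $i\in S$, and $|T_S|$ its $|S|$-dimensional volume. The log-projection vector $\pi(T)$ has entries $\pi(T)_S=\log|T_S|$ indexed by nonempty $S\subseteq[n]$ (with $\log 0=-\infty$). A vector in $\mathbb{R}^{2^n-1}$ (entries indexed by nonempty subsets of $[n]$) is constructible if it equals $\pi(T)$ for some object $T$; $\Psi_n\subseteq\mathbb{R}^{2^n-1}$ is the set of constructible vectors. Let $\mathcal{A}=\{A_i\}_{i=1}^k$, $\mathcal{B}=\{B_j\}_{j=1}^m$ be families (repetitions allowed) of nonempty subsets of $[n]$. We say $\mathcal{A}$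 covers $\mathcal{B}$ if (1) for every $e\in[n]$, $|\{i: e\in A_i\}|=|\{j: e\in B_j\}|$, and (2) with $\Sigma=\{(i,t): t\in A_i\}$ and $\Gamma=\{(j,s): s\in B_j\}$, there is a bijection $f:\Sigma\to\Gamma$ such that whenever $f(i,t)=(j,s)$ we have $t=s$ and $A_i\subseteq B_j$. For such $\mathcal{A},\mathcal{B}$, the (linear) NC inequality is $\sum_{j=1}^m\pi_{B_j}\le\sum_{i=1}^k\pi_{A_i}$. *)

theory Defs
  imports "HOL-Analysis.Analysis"
begin

definition object :: "(real ^ 'n) set \<Rightarrow> bool" where
  "object T \<longleftrightarrow> bounded T \<and> compact T \<and> (\<forall>x\<in>T. \<forall>i. 0 \<le> x $ i)"

text \<open>
  The coordinate subspace spanned by the basis vectors with index in S is identified with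
  the space of functions on S (extensional outside S), i.e. the space of the product measure
  below; orthogonal projection onto it then keeps exactly the coordinates in S.
\<close>

definition proj :: "'n set \<Rightarrow> (real ^ 'n) set \<Rightarrow> ('n \<Rightarrow> real) set" where
  "proj S T = (\<lambda>x. \<lambda>i\<in>S. x $ i) ` T"

definition proj_volume :: "(real ^ 'n) set \<Rightarrow> 'n set \<Rightarrow> real" where
  "proj_volume T S = measure (Pi\<^sub>M S (\<lambda>_. lborel)) (proj S T)"

text \<open>Extended-real values, because \<open>ln 0 = 0\<close> in the library whereas here the log of 0 is minus infinity.\<close>

definition log_proj :: "(real ^ 'n) set \<Rightarrow> 'n set \<Rightarrow> ereal" where
  "log_proj T S = (if proj_volume T S = 0 then -\<infinity> else ereal (ln (proj_volume T S)))"

text \<open>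
  Real vectors indexed by the nonempty subsets. As the entries are finite, only objects all of
  whose projections have positive volume contribute.
\<close>

definition constructible_vectors :: "('n::finite set \<Rightarrow> real) set" (\<open>\<Psi>\<close>) where
  "\<Psi> = {v \<in> {S. S \<noteq> {}} \<rightarrow>\<^sub>E UNIV.
         \<exists>T :: (real ^ 'n) set. object T \<and> (\<forall>S. S \<noteq> {} \<longrightarrow> ereal (v S) = log_proj T S)}"

text \<open>Families with repetitions are lists, indexed from 0.\<close>

definition incidences :: "'n set list \<Rightarrow> (nat \<times> 'n) set" where
  "incidences F = {(i, t). i < length F \<and> t \<in> F ! i}"

definition covers :: "'n set list \<Rightarrow> 'n set list \<Rightarrow> bool" where
  "covers A B \<longleftrightarrow>
     {} \<notin> set A \<and> {} \<notin> set B \<and>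
     (\<forall>e. card {i. i < length A \<and> e \<in> A ! i} = card {j. j < length B \<and> e \<in> B ! j}) \<and>
     (\<exists>f. bij_betw f (incidences A) (incidences B) \<and>
          (\<forall>i t j s. (i, t) \<in> incidences A \<and> f (i, t) = (j, s) \<longrightarrow> t = s \<and> A ! i \<subseteq> B ! j))"

end

theory Submission
  imports Defs
begin

text \<open>
  If \<open>q i\<close> is antitone on the sets containing \<open>i\<close> (for each \<open>i\<close>), a union of boxes realises the
  vector \<open>S \<mapsto> k * (\<Sum>i\<in>S. q i S)\<close> up to a bounded error, so a valid inequality is
  nonpositive on \<open>S \<mapsto> (\<Sum>i\<in>S. q i S)\<close>. Choosing \<open>q\<close> concentrated on a single \<open>e\<close>, Farkas' lemma
  turns this into a flow along inclusions among the sets containing \<open>e\<close> with net inflow \<open>\<alpha> S\<close>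
  at \<open>S\<close>. After padding the diagonals these flows form a nonnegative real solution of homogeneous
  integer equations whose integer solutions encode covers, and every nonnegative real
  solution of such a system is a positive combination of nonnegative integer ones.
\<close>

section \<open>Farkas' lemma for finitely many generators\<close>

text \<open>A finitely generated cone is closed, so a point \<open>w\<close> outside it is strictly
  separated from it by a hyperplane; the negated normal is then nonpositive on all generators but
  positive at \<open>w\<close>.\<close>

lemma farkas:
  fixes g :: "'i \<Rightarrow> 'a::euclidean_space"
  assumes "finite I"
    and dual: "\<And>v. (\<And>i. i \<in> I \<Longrightarrow> v \<bullet> g i \<le> 0) \<Longrightarrow> v \<bullet> w \<le> 0"
  obtains c where "\<And>i. i \<in> I \<Longrightarrow> 0 \<le> (c i :: real)" and "w = (\<Sum>i\<in>I. c i *\<^sub>R g i)"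
proof -
  define H where "H = convex_cone hull (g ` I)"
  define K where "K = {\<Sum>i\<in>I. c i *\<^sub>R g i | c. \<forall>i\<in>I. 0 \<le> (c i :: real)}"
  have "w \<in> H"
  proof (rule ccontr)
    assume "w \<notin> H"
    moreover have "convex H" "closed H"
      using \<open>finite I\<close> by (simp_all add: H_def convex_convex_cone_hull closed_convex_cone_hull)
    ultimately obtain a b where ab: "a \<bullet> w < b" "\<And>x. x \<in> H \<Longrightarrow> b < a \<bullet> x"
      using separating_hyperplane_closed_point by metis
    have "b < 0"
      using ab(2)[of 0] by (simp add: H_def convex_cone_hull_contains_0)
    have "(- a) \<bullet> g i \<le> 0" if "i \<in> I" for i
    proof (rule ccontr)
      assume "\<not> (- a) \<bullet> g i \<le> 0"
      then have neg: "a \<bullet> g i < 0" by simp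
      \<comment> \<open>The factor is a quotient of two negative numbers and brings the value of
        \<open>a\<close> to exactly \<open>b\<close>, against the strict bound on
        \<open>H\<close>.\<close>
      have "(b / (a \<bullet> g i)) *\<^sub>R g i \<in> H"
        unfolding H_def using that neg \<open>b < 0\<close>
        by (intro convex_cone_hull_mul hull_inc) (auto simp: divide_nonpos_nonpos)
      from ab(2)[OF this] neg show False by simp
    qed
    then have "(- a) \<bullet> w \<le> 0" by (rule dual)
    with ab(1) \<open>b < 0\<close> show False by simp
  qed
  \<comment> \<open>The hull is the smallest convex cone containing the generators, so its points
    inherit the explicit form of those in \<open>K\<close>.\<close>
  moreover have "H \<subseteq> K"
    unfolding H_def
  proof (rule hull_minimal)
    show "g ` I \<subseteq> K"
    proof clarify
      fix i assume "i \<in> I"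
      then show "g i \<in> K" unfolding K_def using \<open>finite I\<close>
        by (intro CollectI exI[of _ "\<lambda>j. if j = i then 1 else 0"])
           (simp add: if_distrib[of "\<lambda>c. c *\<^sub>R _"] cong: if_cong)
    qed
    have "x + y \<in> K" if "x \<in> K" "y \<in> K" for x y
    proof -
      from that obtain c d where "x = (\<Sum>i\<in>I. c i *\<^sub>R g i)" "y = (\<Sum>i\<in>I. d i *\<^sub>R g i)"
        "\<forall>i\<in>I. 0 \<le> c i" "\<forall>i\<in>I. 0 \<le> d i"
        unfolding K_def by blast
      then show ?thesis unfolding K_def
        by (intro CollectI exI[of _ "\<lambda>i. c i + d i"]) (simp add: scaleR_add_left sum.distrib)
    qed
    moreover have "t *\<^sub>R x \<in> K" if "x \<in> K" "0 \<le> t" for t x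
    proof -
      from that(1) obtain c where "x = (\<Sum>i\<in>I. c i *\<^sub>R g i)" "\<forall>i\<in>I. 0 \<le> c i"
        unfolding K_def by blast
      then show ?thesis unfolding K_def using that(2)
        by (intro CollectI exI[of _ "\<lambda>i. t * c i"]) (simp add: scaleR_sum_right)
    qed
    moreover have "0 \<in> K"
      unfolding K_def by (intro CollectI exI[of _ "\<lambda>_. 0"]) simp
    ultimately show "convex_cone K"
      unfolding convex_cone_iff by blast
  qed
  ultimately show ?thesis
    using that unfolding K_def by blast
qed

section \<open>Integer solutions of balance equations\<close>

text \<open>
  Simultaneous Diophantine approximation: round a large multiple of \<open>x\<close> to integers; the defects
  of the equations are then integers of absolute value less than 1.
\<close>

lemma balanced_nat_solution:
  fixes x :: "'i::finite \<Rightarrow> real"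
  assumes nonneg: "\<And>i. 0 \<le> x i"
    and bal: "\<And>P Q. (P, Q) \<in> E \<Longrightarrow> sum x P = sum x Q"
  obtains z :: "'i \<Rightarrow> nat"
  where "\<And>P Q. (P, Q) \<in> E \<Longrightarrow> sum z P = sum z Q" and "\<And>i. z i = 0 \<longleftrightarrow> x i = 0"
proof -
  \<comment> \<open>The approximation theorem speaks of reals indexed by naturals below
    \<open>n\<close>, hence the enumeration \<open>h\<close> of the index type.\<close>
  define n where "n = CARD('i)"
  obtain h :: "'i \<Rightarrow> nat" where h: "bij_betw h UNIV {..<n}"
    unfolding n_def using ex_bij_betw_finite_nat[of "UNIV :: 'i set"] by (auto simp: lessThan_atLeast0)
  define hi where "hi = inv_into UNIV h"
  have hi: "hi (h i) = i" for i
    using h by (simp add: hi_def bij_betw_def)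
  have hn: "h i < n" for i
    using h by (auto simp: bij_betw_def)
  \<comment> \<open>The bound \<open>2 * n < N\<close> keeps the difference of two sums of defects,
    each at most \<open>n / N\<close>, below 1; the bound \<open>1 / x i < N\<close> makes every
    nonzero entry exceed the rounding error, so it stays positive after rounding.\<close>
  obtain N :: nat where N: "2 * n < N" "\<And>i. x i \<noteq> 0 \<Longrightarrow> 1 / x i < N"
  proof -
    have "\<forall>i. \<exists>m::nat. 1 / x i < m" using reals_Archimedean2 by blast
    then obtain m :: "'i \<Rightarrow> nat" where m: "\<And>i. 1 / x i < m i" by metis
    show ?thesis
    proof (rule that[of "2 * n + 1 + (\<Sum>i\<in>UNIV. m i)"])
      fix i
      have "m i \<le> (\<Sum>i\<in>UNIV. m i)" by (rule member_le_sum) auto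
      with m[of i] show "1 / x i < real (2 * n + 1 + (\<Sum>i\<in>UNIV. m i))" by linarith
    qed simp
  qed
  then have "N > 0" by simp
  then obtain q p where q: "0 < q"
    and p: "\<And>j. j < n \<Longrightarrow> \<bar>of_int q * x (hi j) - of_int (p j)\<bar> < 1 / N"
    using Dirichlet_approx_simult[of N n "\<lambda>j. x (hi j)"] by metis
  define d where "d i = of_int (p (h i)) - of_int q * x i" for i
  have d: "\<bar>d i\<bar> < 1 / N" for i
    using p[OF hn, of i] by (simp add: d_def hi abs_minus_commute)
  have small: "1 / N < x i" if "x i \<noteq> 0" for i
    using N(2)[OF that] nonneg[of i] that \<open>N > 0\<close> by (simp add: field_simps)
  have N1: "1 / real N \<le> 1" using \<open>N > 0\<close> by simp
  have pos: "p (h i) > 0" if "x i \<noteq> 0" for i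
  proof -
    have "x i \<le> of_int q * x i" using q nonneg[of i] by (simp add: mult_le_cancel_right1)
    with d[of i] small[OF that] have "0 < real_of_int (p (h i))" by (auto simp: d_def)
    then show ?thesis by simp
  qed
  have zero: "p (h i) = 0" if "x i = 0" for i
  proof -
    have "\<bar>real_of_int (p (h i))\<bar> < 1" using d[of i] N1 that by (simp add: d_def)
    then show ?thesis by linarith
  qed
  have pnn: "p (h i) \<ge> 0" for i using pos[of i] zero[of i] by fastforce
  show ?thesis
  proof (rule that[of "\<lambda>i. nat (p (h i))"])
    fix i show "nat (p (h i)) = 0 \<longleftrightarrow> x i = 0"
      using pos[of i] zero[of i] by fastforce
  next
    fix P Q assume PQ: "(P, Q) \<in> E"
    have bound: "\<bar>sum d P\<bar> \<le> n / N" for P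
    proof -
      have "\<bar>sum d P\<bar> \<le> (\<Sum>i\<in>P. \<bar>d i\<bar>)" by (rule sum_abs)
      also have "\<dots> \<le> (\<Sum>i\<in>UNIV. \<bar>d i\<bar>)" by (rule sum_mono2) auto
      also have "\<dots> \<le> (\<Sum>i\<in>(UNIV::'i set). 1 / N)" using d by (intro sum_mono less_imp_le)
      finally show ?thesis by (simp add: n_def)
    qed
    have split: "sum d P = real_of_int (\<Sum>i\<in>P. p (h i)) - of_int q * sum x P" for P
      by (simp add: d_def sum_subtractf sum_distrib_left)
    \<comment> \<open>The multiples of \<open>q\<close> cancel by the balance of \<open>x\<close>,
      leaving only rounding defects.\<close>
    have "\<bar>real_of_int ((\<Sum>i\<in>P. p (h i)) - (\<Sum>i\<in>Q. p (h i)))\<bar> = \<bar>sum d P - sum d Q\<bar>"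
      using bal[OF PQ] by (simp add: split)
    also have "\<dots> \<le> 2 * n / N" using bound[of P] bound[of Q] by linarith
    also have "\<dots> < 1" using N(1) by (simp add: field_simps)
    finally have "(\<Sum>i\<in>P. p (h i)) = (\<Sum>i\<in>Q. p (h i))" by linarith
    then have "int (\<Sum>i\<in>P. nat (p (h i))) = int (\<Sum>i\<in>Q. nat (p (h i)))"
      using pnn by simp
    then show "(\<Sum>i\<in>P. nat (p (h i))) = (\<Sum>i\<in>Q. nat (p (h i)))" by (rule of_nat_eq_iff[THEN iffD1])
  qed
qed

text \<open>Induction on the size of the support: subtract from \<open>x\<close> the largest
  multiple of an integer solution with the same support that keeps all entries nonnegative. This
  preserves the equations and makes at least one more entry vanish.\<close>

lemma balanced_nat_decomposition:
  fixes x :: "'i::finite \<Rightarrow> real"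
  assumes "\<And>i. 0 \<le> x i" and "\<And>P Q. (P, Q) \<in> E \<Longrightarrow> sum x P = sum x Q"
  shows "\<exists>(R::nat) (\<mu> :: nat \<Rightarrow> real) (z :: nat \<Rightarrow> 'i \<Rightarrow> nat).
           (\<forall>r<R. \<mu> r > 0 \<and> (\<forall>(P, Q)\<in>E. sum (z r) P = sum (z r) Q)) \<and>
           (\<forall>i. x i = (\<Sum>r<R. \<mu> r * real (z r i)))"
  using assms
proof (induction "card {i. x i \<noteq> 0}" arbitrary: x rule: less_induct)
  case less
  show ?case
  proof (cases "\<forall>i. x i = 0")
    case True
    then show ?thesis by (intro exI[of _ 0]) simp
  next
    case False
    obtain z0 :: "'i \<Rightarrow> nat" where z0: "\<And>P Q. (P, Q) \<in> E \<Longrightarrow> sum z0 P = sum z0 Q"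
      and z0_iff: "\<And>i. z0 i = 0 \<longleftrightarrow> x i = 0"
      using balanced_nat_solution[of x E] less.prems by metis
    define J where "J = {i. x i \<noteq> 0}"
    \<comment> \<open>The minimal ratio; at an index \<open>k\<close> attaining it the new entry is
      0.\<close>
    define t where "t = Min ((\<lambda>i. x i / z0 i) ` J)"
    have J: "finite J" "J \<noteq> {}" using False by (auto simp: J_def)
    have t_le: "t \<le> x i / z0 i" if "i \<in> J" for i
      unfolding t_def using J that by simp
    have "t \<in> (\<lambda>i. x i / z0 i) ` J" unfolding t_def using J by (intro Min_in) auto
    then obtain k where k: "k \<in> J" "t = x k / z0 k" by blast
    have zpos: "0 < z0 i" if "i \<in> J" for i using z0_iff[of i] that by (auto simp: J_def)
    have "x k > 0" using k(1) less.prems(1)[of k] by (simp add: J_def order_less_le)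
    then have t_pos: "t > 0" using zpos[OF k(1)] by (simp add: k(2))
    define x' where "x' i = x i - t * z0 i" for i
    have "x' k = 0" using zpos[OF k(1)] by (simp add: x'_def k(2))
    moreover have "x' i = 0" if "x i = 0" for i using z0_iff[of i] that by (simp add: x'_def)
    ultimately have "{i. x' i \<noteq> 0} \<subset> {i. x i \<noteq> 0}"
      using k(1) unfolding J_def by blast
    then have "card {i. x' i \<noteq> 0} < card {i. x i \<noteq> 0}" by (intro psubset_card_mono) auto
    moreover have "0 \<le> x' i" for i
    proof (cases "i \<in> J")
      case True
      then show ?thesis using t_le[OF True] zpos[OF True] by (simp add: x'_def field_simps)
    next
      case False
      then show ?thesis using z0_iff[of i] by (simp add: x'_def J_def)
    qed
    moreover have "sum x' P = sum x' Q" if "(P, Q) \<in> E" for P Q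
    proof -
      have "real (sum z0 P) = real (sum z0 Q)" using z0[OF that] by simp
      then show ?thesis using less.prems(2)[OF that]
        by (simp add: x'_def sum_subtractf flip: sum_distrib_left)
    qed
    ultimately obtain R :: nat and \<mu> :: "nat \<Rightarrow> real" and z :: "nat \<Rightarrow> 'i \<Rightarrow> nat" where IH:
      "\<forall>r<R. \<mu> r > 0 \<and> (\<forall>(P, Q)\<in>E. sum (z r) P = sum (z r) Q)"
      "\<forall>i. x' i = (\<Sum>r<R. \<mu> r * real (z r i))"
      using less.hyps[of x'] by blast
    have "x i = (\<Sum>r<Suc R. (\<mu>(R := t)) r * real ((z(R := z0)) r i))" for i
    proof -
      have "(\<Sum>r<Suc R. (\<mu>(R := t)) r * real ((z(R := z0)) r i)) = x' i + t * z0 i"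
        using IH(2) by simp
      then show ?thesis by (simp add: x'_def)
    qed
    moreover have "\<forall>r<Suc R. (\<mu>(R := t)) r > 0 \<and> (\<forall>(P, Q)\<in>E. sum ((z(R := z0)) r) P = sum ((z(R := z0)) r) Q)"
      using IH(1) t_pos z0 by (auto simp: less_Suc_eq)
    ultimately show ?thesis by blast
  qed
qed

section \<open>From integer flows to covers\<close>

text \<open>Fibres over the same value have equal size, so bijections between them can be glued. It
  serves to match list positions with units of flow.\<close>

lemma fiberwise_bij:
  assumes "finite X" "finite Y"
    and card: "\<And>c. card {x \<in> X. f x = c} = card {y \<in> Y. g y = c}"
  obtains h where "bij_betw h X Y" and "\<And>x. x \<in> X \<Longrightarrow> g (h x) = f x"
proof -
  have "\<exists>h. bij_betw h {x \<in> X. f x = c} {y \<in> Y. g y = c}" for c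
    using card[of c] assms(1,2) by (intro finite_same_card_bij) auto
  then obtain h where h: "\<And>c. bij_betw (h c) {x \<in> X. f x = c} {y \<in> Y. g y = c}" by metis
  have hX: "h (f x) x \<in> Y \<and> g (h (f x) x) = f x" if "x \<in> X" for x
    using bij_betwE[OF h[of "f x"]] that by auto
  have "inj_on (\<lambda>x. h (f x) x) X"
  proof (rule inj_onI)
    fix x y assume xy: "x \<in> X" "y \<in> X" "h (f x) x = h (f y) y"
    then have "f x = f y" using hX by metis
    then show "x = y" using xy h[of "f x"] by (auto simp: bij_betw_def inj_on_def)
  qed
  moreover have "Y \<subseteq> (\<lambda>x. h (f x) x) ` X"
  proof
    fix y assume "y \<in> Y"
    then have "y \<in> h (g y) ` {x \<in> X. f x = g y}" using h[of "g y"] by (auto simp: bij_betw_def)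
    then obtain x where "x \<in> X" "f x = g y" "y = h (g y) x" by blast
    then show "y \<in> (\<lambda>x. h (f x) x) ` X" by (intro image_eqI[of _ _ x]) simp_all
  qed
  ultimately have "bij_betw (\<lambda>x. h (f x) x) X Y" using hX by (auto simp: bij_betw_def)
  then show ?thesis using that hX by blast
qed

lemma list_with_counts:
  fixes m :: "'a::finite \<Rightarrow> nat"
  obtains xs where "\<And>a. count_list xs a = m a"
proof -
  obtain xs where "mset xs = (\<Sum>a\<in>UNIV. replicate_mset (m a) a)" using ex_mset by blast
  then have "count_list xs a = m a" for a
    by (simp add: count_mset[symmetric] count_sum)
  then show ?thesis using that by blast
qed

lemma card_positions_eq_count_list: "card {i. i < length xs \<and> xs ! i = a} = count_list xs a"
proof -
  have "{i. i < length xs \<and> xs ! i = a} = {i. i < length xs \<and> a = xs ! i}" by auto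
  then show ?thesis by (simp add: count_list_eq_length_filter length_filter_conv_card)
qed

text \<open>Read \<open>z e S T\<close> as the number of incidences of \<open>e\<close> in copies of
  \<open>S\<close> in \<open>A\<close> that are sent to copies of \<open>T\<close> in
  \<open>B\<close>. For fixed \<open>e\<close>, units of flow are matched with positions of
  \<open>A\<close> by their source and with positions of \<open>B\<close> by their target; composing
  the two matchings sends each set to a superset.\<close>

lemma coversI_transport:
  fixes z :: "'n::finite \<Rightarrow> 'n set \<Rightarrow> 'n set \<Rightarrow> nat"
  assumes "{} \<notin> set A" "{} \<notin> set B"
    and supp: "\<And>e S T. z e S T > 0 \<Longrightarrow> e \<in> S \<and> S \<subseteq> T"
    and rows: "\<And>e S. e \<in> S \<Longrightarrow> (\<Sum>T\<in>UNIV. z e S T) = count_list A S"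
    and cols: "\<And>e T. e \<in> T \<Longrightarrow> (\<Sum>S\<in>UNIV. z e S T) = count_list B T"
  shows "covers A B"
proof -
  define I where "I F e = {i. i < length F \<and> e \<in> F ! i}" for F and e :: 'n
  have fin: "finite (I F e)" for F e by (simp add: I_def)
  have fib: "card {i \<in> I F e. F ! i = S} = (if e \<in> S then count_list F S else 0)" for F e S
  proof -
    have "{i \<in> I F e. F ! i = S} = (if e \<in> S then {i. i < length F \<and> F ! i = S} else {})"
      by (auto simp: I_def)
    then show ?thesis by (simp add: card_positions_eq_count_list)
  qed
  have "\<exists>h. bij_betw h (I A e) (I B e) \<and> (\<forall>i\<in>I A e. A ! i \<subseteq> B ! h i)" for e
  proof -
    \<comment> \<open>One element \<open>((S, T), k)\<close> for each unit of flow from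
      \<open>S\<close> to \<open>T\<close>.\<close>
    define Z where "Z = (SIGMA p:UNIV. {..<z e (fst p) (snd p)})"
    have "finite Z" by (simp add: Z_def)
    have Zsub: "S \<subseteq> T" "e \<in> S" if "((S, T), k) \<in> Z" for S T k
      using that supp[of e S T] by (auto simp: Z_def)
    have rowfib: "card {w \<in> Z. fst (fst w) = S} = (\<Sum>T\<in>UNIV. z e S T)" for S
    proof -
      have "{w \<in> Z. fst (fst w) = S} = (SIGMA p:Pair S ` UNIV. {..<z e (fst p) (snd p)})"
        by (auto simp: Z_def)
      then show ?thesis by (simp add: card_SigmaI sum.reindex inj_on_def)
    qed
    have colfib: "card {w \<in> Z. snd (fst w) = T} = (\<Sum>S\<in>UNIV. z e S T)" for T
    proof -
      have "{w \<in> Z. snd (fst w) = T} = (SIGMA p:(\<lambda>S. (S, T)) ` UNIV. {..<z e (fst p) (snd p)})"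
        by (auto simp: Z_def)
      then show ?thesis by (simp add: card_SigmaI sum.reindex inj_on_def)
    qed
    \<comment> \<open>Sets without \<open>e\<close> carry no flow of \<open>e\<close>, in agreement
      with their absence from \<open>I A e\<close> and \<open>I B e\<close>.\<close>
    have row0: "(\<Sum>T\<in>UNIV. z e S T) = 0" if "e \<notin> S" for S
      using supp[of e S] that by (force intro: sum.neutral)
    have col0: "(\<Sum>S\<in>UNIV. z e S T) = 0" if "e \<notin> T" for T
      using supp[of e _ T] that by (force intro: sum.neutral)
    have "card {i \<in> I A e. A ! i = S} = card {w \<in> Z. fst (fst w) = S}" for S
      unfolding fib rowfib using rows[of e S] row0[of S] by simp
    then obtain h1 where h1: "bij_betw h1 (I A e) Z" "\<And>i. i \<in> I A e \<Longrightarrow> fst (fst (h1 i)) = A ! i"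
      using fiberwise_bij[of "I A e" Z "\<lambda>i. A ! i" "\<lambda>w. fst (fst w)"] fin \<open>finite Z\<close> by metis
    have "card {w \<in> Z. snd (fst w) = T} = card {i \<in> I B e. B ! i = T}" for T
      unfolding fib colfib using cols[of e T] col0[of T] by simp
    then obtain h2 where h2: "bij_betw h2 Z (I B e)" "\<And>w. w \<in> Z \<Longrightarrow> B ! h2 w = snd (fst w)"
      using fiberwise_bij[of Z "I B e" "\<lambda>w. snd (fst w)" "\<lambda>i. B ! i"] fin \<open>finite Z\<close> by metis
    have "A ! i \<subseteq> B ! h2 (h1 i)" if "i \<in> I A e" for i
    proof -
      have "h1 i \<in> Z" using h1(1) that by (auto simp: bij_betw_def)
      then have "fst (fst (h1 i)) \<subseteq> snd (fst (h1 i))"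
        by (metis Zsub(1) prod.collapse)
      then show ?thesis using h1(2)[OF that] h2(2)[OF \<open>h1 i \<in> Z\<close>] by simp
    qed
    then show ?thesis
      using bij_betw_trans[OF h1(1) h2(1)] by (intro exI[of _ "h2 \<circ> h1"]) simp
  qed
  then obtain h where h: "\<And>e. bij_betw (h e) (I A e) (I B e)"
    and sub: "\<And>e i. i \<in> I A e \<Longrightarrow> A ! i \<subseteq> B ! h e i"
    by metis
  have inc: "incidences F = {(i, t). i \<in> I F t}" for F
    by (auto simp: incidences_def I_def)
  \<comment> \<open>The bijections for the different elements act on disjoint parts of the
    incidences, since the second component is kept.\<close>
  define f where "f = (\<lambda>(i, t). (h t i, t))"
  have "bij_betw f (incidences A) (incidences B)"
  proof (rule bij_betw_imageI)
    show "inj_on f (incidences A)"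
      using h by (auto simp: inj_on_def f_def inc bij_betw_def)
    show "f ` incidences A = incidences B"
    proof
      show "f ` incidences A \<subseteq> incidences B"
        using h by (auto simp: f_def inc bij_betw_def)
      show "incidences B \<subseteq> f ` incidences A"
      proof clarify
        fix j t assume "(j, t) \<in> incidences B"
        then have "j \<in> h t ` I A t" using h[of t] by (auto simp: inc bij_betw_def)
        then show "(j, t) \<in> f ` incidences A" by (force simp: f_def inc)
      qed
    qed
  qed
  moreover have "card {i. i < length A \<and> e \<in> A ! i} = card {j. j < length B \<and> e \<in> B ! j}" for e
    using bij_betw_same_card[OF h[of e]] by (simp add: I_def)
  ultimately show ?thesis
    unfolding covers_def using assms(1,2) sub
    by (intro conjI allI exI[of _ f]) (auto simp: f_def inc)
qed

section \<open>Objects built from boxes\<close>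

lemma proj_cbox:
  fixes b :: "real ^ 'n::finite"
  assumes "\<And>i. 0 \<le> b $ i"
  shows "proj S (cbox 0 b) = (\<Pi>\<^sub>E i\<in>S. {0..b $ i})"
proof
  show "proj S (cbox 0 b) \<subseteq> (\<Pi>\<^sub>E i\<in>S. {0..b $ i})"
    by (auto simp: proj_def mem_box_cart)
  show "(\<Pi>\<^sub>E i\<in>S. {0..b $ i}) \<subseteq> proj S (cbox 0 b)"
  proof
    fix f assume f: "f \<in> (\<Pi>\<^sub>E i\<in>S. {0..b $ i})"
    \<comment> \<open>Filling the coordinates outside \<open>S\<close> with 0 stays in the box
      because \<open>b\<close> is nonnegative.\<close>
    define x :: "real ^ 'n" where "x = (\<chi> i. if i \<in> S then f i else 0)"
    have "x \<in> cbox 0 b" using f assms by (auto simp: x_def mem_box_cart PiE_iff)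
    moreover have "f = (\<lambda>i\<in>S. x $ i)" using f by (auto simp: x_def PiE_iff extensional_def restrict_def)
    ultimately show "f \<in> proj S (cbox 0 b)" unfolding proj_def by blast
  qed
qed

lemma emeasure_lborel_PiE_box:
  assumes "finite S" "\<And>i. i \<in> S \<Longrightarrow> 0 \<le> b i"
  shows "emeasure (Pi\<^sub>M S (\<lambda>_. lborel)) (\<Pi>\<^sub>E i\<in>S. {0..b i}) = ennreal (\<Prod>i\<in>S. b i)"
proof -
  interpret product_sigma_finite "\<lambda>_. lborel :: real measure" ..
  show ?thesis using assms by (subst emeasure_PiM) (auto simp: prod_ennreal intro!: prod.cong)
qed

text \<open>
  The box with index \<open>U\<close> has side \<open>exp (q i U)\<close> in direction \<open>i \<in> U\<close> and is flat in the remaining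
  directions, so it contributes to \<open>|T\<^sub>S|\<close> only if \<open>S \<subseteq> U\<close>, and then at most as much
  as the box with index \<open>S\<close>.
\<close>

lemma object_with_projections_near:
  fixes q :: "'n::finite \<Rightarrow> 'n set \<Rightarrow> real"
  assumes anti: "\<And>i S U. i \<in> S \<Longrightarrow> S \<subseteq> U \<Longrightarrow> q i U \<le> q i S"
  obtains T where "object T"
    and "\<And>S. exp (\<Sum>i\<in>S. q i S) \<le> proj_volume T S"
    and "\<And>S. proj_volume T S \<le> real CARD('n set) * exp (\<Sum>i\<in>S. q i S)"
proof -
  define b :: "'n set \<Rightarrow> real ^ 'n" where "b U = (\<chi> i. if i \<in> U then exp (q i U) else 0)" for U
  define T where "T = (\<Union>U. cbox 0 (b U))"
  have b0: "0 \<le> b U $ i" for U i by (simp add: b_def)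
  have obj: "object T"
    unfolding object_def T_def
    by (auto simp: mem_box_cart intro!: compact_UN bounded_UN)
  define X where "X S U = (\<Pi>\<^sub>E i\<in>S. {0..b U $ i})" for S U
  let ?M = "\<lambda>S. Pi\<^sub>M S (\<lambda>_. lborel :: real measure)"
  have em: "emeasure (?M S) (X S U) = ennreal (\<Prod>i\<in>S. b U $ i)" for S U
    unfolding X_def by (rule emeasure_lborel_PiE_box) (auto simp: b0)
  have X: "X S U \<in> sets (?M S)" for S U
    unfolding X_def by (intro sets_PiM_I_finite) auto
  have meas: "measure (?M S) (X S U) = (\<Prod>i\<in>S. b U $ i)" for S U
    using em[of S U] by (simp add: measure_def b0 prod_nonneg)
  have fmeas: "X S U \<in> fmeasurable (?M S)" for S U
    using X em by (intro fmeasurableI) (auto simp: ennreal_less_top)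
  have pT: "proj S T = (\<Union>U. X S U)" for S
    unfolding X_def T_def proj_cbox[OF b0, symmetric] by (auto simp: proj_def)
  have le: "(\<Prod>i\<in>S. b U $ i) \<le> exp (\<Sum>i\<in>S. q i S)" for S U
  proof (cases "S \<subseteq> U")
    case True
    then have "(\<Prod>i\<in>S. b U $ i) = exp (\<Sum>i\<in>S. q i U)"
      by (auto simp: b_def exp_sum intro!: prod.cong)
    also have "\<dots> \<le> exp (\<Sum>i\<in>S. q i S)" using anti True by (auto intro!: sum_mono)
    finally show ?thesis .
  next
    case False
    then obtain i where "i \<in> S" "i \<notin> U" by blast
    then have "(\<Prod>i\<in>S. b U $ i) = 0" by (intro prod_zero) (auto simp: b_def)
    then show ?thesis by (simp only: exp_ge_zero)
  qed
  show ?thesis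
  proof (rule that[OF obj])
    fix S :: "'n set"
    \<comment> \<open>The box with index \<open>S\<close> alone gives the lower bound; the upper
      bound is subadditivity over all index sets \<open>U\<close>, each contributing at most this
      much.\<close>
    have "exp (\<Sum>i\<in>S. q i S) = measure (?M S) (X S S)"
      by (simp add: meas b_def exp_sum)
    also have "\<dots> \<le> measure (?M S) (\<Union>U. X S U)"
      by (rule measure_mono_fmeasurable) (auto intro: X fmeas)
    finally show "exp (\<Sum>i\<in>S. q i S) \<le> proj_volume T S"
      by (simp add: proj_volume_def pT)
    have "measure (?M S) (\<Union>U. X S U) \<le> (\<Sum>U\<in>UNIV. measure (?M S) (X S U))"
      by (rule measure_UNION_le) (auto intro: X)
    also have "\<dots> \<le> (\<Sum>U\<in>(UNIV :: 'n set set). exp (\<Sum>i\<in>S. q i S))"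
      unfolding meas by (intro sum_mono le)
    finally show "proj_volume T S \<le> real CARD('n set) * exp (\<Sum>i\<in>S. q i S)"
      by (simp add: proj_volume_def pT)
  qed
qed

section \<open>Consequences of validity\<close>

text \<open>The weights \<open>k * q\<close> are antitone as well, and the log-projections of their
  objects differ from \<open>k * V\<close> by at most \<open>L\<close> in each entry, whatever
  \<open>k\<close> is. Hence all natural multiples of the sum stay below the constant
  \<open>D\<close>, which forces the sum to be nonpositive.\<close>

lemma valid_inequality_on_antitone_weights:
  fixes \<alpha> :: "'n::finite set \<Rightarrow> real" and q :: "'n \<Rightarrow> 'n set \<Rightarrow> real"
  assumes valid: "\<forall>v \<in> (\<Psi> :: ('n set \<Rightarrow> real) set). (\<Sum>S | S \<noteq> {}. \<alpha> S * v S) \<le> 0"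
    and anti: "\<And>i S U. i \<in> S \<Longrightarrow> S \<subseteq> U \<Longrightarrow> q i U \<le> q i S"
  shows "(\<Sum>S | S \<noteq> {}. \<alpha> S * (\<Sum>i\<in>S. q i S)) \<le> 0"
proof -
  define L where "L = ln (real CARD('n set))"
  define V where "V S = (\<Sum>i\<in>S. q i S)" for S
  define D where "D = (\<Sum>S | S \<noteq> {}. \<bar>\<alpha> S\<bar> * L)"
  have bound: "real k * (\<Sum>S | S \<noteq> {}. \<alpha> S * V S) \<le> D" for k :: nat
  proof -
    obtain T where T: "object T"
      "\<And>S. exp (\<Sum>i\<in>S. k * q i S) \<le> proj_volume T S"
      "\<And>S. proj_volume T S \<le> real CARD('n set) * exp (\<Sum>i\<in>S. k * q i S)"
      using object_with_projections_near[of "\<lambda>i S. k * q i S"] anti by (metis mult_left_mono of_nat_0_le_iff)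
    have kV: "(\<Sum>i\<in>S. k * q i S) = k * V S" for S by (simp add: V_def sum_distrib_left)
    have pos: "0 < proj_volume T S" for S
      using T(2)[of S] by (meson exp_gt_zero less_le_trans)
    \<comment> \<open>Positive volumes make every log finite; the restriction is there because
      members of \<open>\<Psi>\<close> are extensional.\<close>
    define v where "v = (\<lambda>S\<in>{S. S \<noteq> {}}. ln (proj_volume T S))"
    have "v \<in> \<Psi>"
      unfolding constructible_vectors_def using T(1) pos
      by (auto simp: v_def log_proj_def less_imp_neq[symmetric] intro!: exI[of _ T])
    then have v0: "(\<Sum>S | S \<noteq> {}. \<alpha> S * v S) \<le> 0" using valid by blast
    have near: "\<bar>k * V S - v S\<bar> \<le> L" if "S \<noteq> {}" for S
    proof -
      have "k * V S \<le> ln (proj_volume T S)"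
        using T(2)[of S] pos[of S] by (simp add: kV ln_ge_iff)
      moreover have "ln (proj_volume T S) \<le> ln (real CARD('n set) * exp (k * V S))"
        using T(3)[of S] pos[of S] by (simp add: kV)
      moreover have "ln (real CARD('n set) * exp (k * V S)) = L + k * V S"
        by (simp add: L_def ln_mult)
      ultimately show ?thesis using that by (simp add: v_def)
    qed
    have "real k * (\<Sum>S | S \<noteq> {}. \<alpha> S * V S) =
        (\<Sum>S | S \<noteq> {}. \<alpha> S * v S) + (\<Sum>S | S \<noteq> {}. \<alpha> S * (k * V S - v S))"
      by (simp add: sum_distrib_left sum.distrib[symmetric] algebra_simps)
    also have "(\<Sum>S | S \<noteq> {}. \<alpha> S * (k * V S - v S)) \<le> D"
      unfolding D_def
    proof (rule sum_mono)
      fix S :: "'n set" assume "S \<in> {S. S \<noteq> {}}"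
      then have "\<bar>\<alpha> S\<bar> * \<bar>k * V S - v S\<bar> \<le> \<bar>\<alpha> S\<bar> * L" using near by (simp add: mult_left_mono)
      then show "\<alpha> S * (k * V S - v S) \<le> \<bar>\<alpha> S\<bar> * L"
        by (metis abs_ge_self abs_mult order_trans)
    qed
    finally show ?thesis using v0 by linarith
  qed
  have "(\<Sum>S | S \<noteq> {}. \<alpha> S * V S) \<le> 0"
  proof (rule ccontr)
    assume "\<not> (\<Sum>S | S \<noteq> {}. \<alpha> S * V S) \<le> 0"
    then obtain k :: nat where "D < real k * (\<Sum>S | S \<noteq> {}. \<alpha> S * V S)"
      using ex_less_of_nat_mult[of "\<Sum>S | S \<noteq> {}. \<alpha> S * V S" D] by auto
    with bound[of k] show False by simp
  qed
  then show ?thesis by (simp add: V_def)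
qed

text \<open>The vector \<open>axis T 1 - axis S 1\<close> is the net inflow of one unit sent from
  \<open>S\<close> to \<open>T\<close>. A functional \<open>v\<close> is nonpositive on all of these
  for inclusions within the sets containing \<open>e\<close> exactly when it is antitone there, so
  Farkas' lemma applies to \<open>\<alpha>\<close> restricted to these sets.\<close>

lemma valid_inequality_flow:
  fixes \<alpha> :: "'n::finite set \<Rightarrow> real"
  assumes valid: "\<forall>v \<in> (\<Psi> :: ('n set \<Rightarrow> real) set). (\<Sum>S | S \<noteq> {}. \<alpha> S * v S) \<le> 0"
  shows "\<exists>y :: 'n set \<Rightarrow> 'n set \<Rightarrow> real.
    (\<forall>S T. 0 \<le> y S T \<and> (y S T \<noteq> 0 \<longrightarrow> e \<in> S \<and> S \<subseteq> T)) \<and>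
    (\<forall>S. e \<in> S \<longrightarrow> \<alpha> S = (\<Sum>R\<in>UNIV. y R S) - (\<Sum>T\<in>UNIV. y S T))"
proof -
  define I where "I = {(S, T). e \<in> S \<and> S \<subseteq> T}"
  define g :: "'n set \<times> 'n set \<Rightarrow> real ^ 'n set" where "g = (\<lambda>(S, T). axis T 1 - axis S 1)"
  define w :: "real ^ 'n set" where "w = (\<chi> S. if e \<in> S then \<alpha> S else 0)"
  have "finite I" by (rule finite)
  moreover have "v \<bullet> w \<le> 0" if v: "\<And>p. p \<in> I \<Longrightarrow> v \<bullet> g p \<le> 0" for v
  proof -
    \<comment> \<open>With all weight on \<open>e\<close>, the sum over \<open>i \<in> S\<close> is
      \<open>v $ S\<close> if \<open>e \<in> S\<close> and 0 otherwise.\<close>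
    define q where "q i S = (if i = e then v $ S else 0)" for i and S :: "'n set"
    have "q i U \<le> q i S" if "i \<in> S" "S \<subseteq> U" for i S U
      using v[of "(S, U)"] that
      by (auto simp: q_def I_def g_def inner_diff_right inner_axis)
    then have "(\<Sum>S | S \<noteq> {}. \<alpha> S * (\<Sum>i\<in>S. q i S)) \<le> 0"
      using valid_inequality_on_antitone_weights[OF valid, of q] by blast
    also have "(\<Sum>S | S \<noteq> {}. \<alpha> S * (\<Sum>i\<in>S. q i S)) = v \<bullet> w"
      unfolding inner_vec_def
      by (intro sum.mono_neutral_cong_left) (auto simp: q_def w_def)
    finally show ?thesis .
  qed
  ultimately obtain c where c: "\<And>p. p \<in> I \<Longrightarrow> 0 \<le> (c p :: real)" and w: "w = (\<Sum>p\<in>I. c p *\<^sub>R g p)"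
    using farkas[of I g w] by metis
  define y where "y S T = (if (S, T) \<in> I then c (S, T) else 0)" for S T
  have "\<alpha> U = (\<Sum>R\<in>UNIV. y R U) - (\<Sum>T\<in>UNIV. y U T)" if "e \<in> U" for U
  proof -
    have "\<alpha> U = w $ U" using that by (simp add: w_def)
    also have "\<dots> = (\<Sum>p\<in>I. c p * g p $ U)" by (simp add: w)
    \<comment> \<open>Coordinate \<open>U\<close> receives what enters \<open>U\<close> minus what
      leaves it; the two terms cancel for a loop with \<open>S = T = U\<close>.\<close>
    also have "\<dots> = (\<Sum>p\<in>UNIV. case p of (S, T) \<Rightarrow>
        (if T = U then y S T else 0) - (if S = U then y S T else 0))"
      by (intro sum.mono_neutral_cong_left) (auto simp: y_def g_def axis_def)
    also have "\<dots> = (\<Sum>S\<in>UNIV. \<Sum>T\<in>UNIV. (if T = U then y S T else 0) - (if S = U then y S T else 0))"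
      by (simp add: sum.cartesian_product)
    also have "\<dots> = (\<Sum>S\<in>UNIV. y S U) - (\<Sum>S\<in>UNIV. \<Sum>T\<in>UNIV. if S = U then y S T else 0)"
      by (simp add: sum_subtractf)
    also have "(\<Sum>S\<in>UNIV. \<Sum>T\<in>UNIV. if S = U then y S T else 0) = (\<Sum>T\<in>UNIV. y U T)"
      by (subst sum.swap) simp
    finally show ?thesis .
  qed
  moreover have "0 \<le> y S T" "y S T \<noteq> 0 \<longrightarrow> e \<in> S \<and> S \<subseteq> T" for S T
    using c by (auto simp: y_def I_def)
  ultimately show ?thesis by (intro exI[of _ y]) simp
qed

text \<open>
  Adding a large enough constant to the diagonal \<open>S = T\<close> of each flow leaves its net divergence
  unchanged and makes its row sums, hence also its column sums, independent of \<open>e\<close>.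
\<close>

lemma valid_inequality_transport:
  fixes \<alpha> :: "'n::finite set \<Rightarrow> real"
  assumes valid: "\<forall>v \<in> (\<Psi> :: ('n set \<Rightarrow> real) set). (\<Sum>S | S \<noteq> {}. \<alpha> S * v S) \<le> 0"
  obtains x :: "'n \<Rightarrow> 'n set \<Rightarrow> 'n set \<Rightarrow> real" and a :: "'n set \<Rightarrow> real"
  where "\<And>e S T. 0 \<le> x e S T" and "\<And>e S T. x e S T \<noteq> 0 \<Longrightarrow> e \<in> S \<and> S \<subseteq> T"
    and "\<And>e S. e \<in> S \<Longrightarrow> (\<Sum>T\<in>UNIV. x e S T) = a S"
    and "\<And>e S. e \<in> S \<Longrightarrow> (\<Sum>R\<in>UNIV. x e R S) = a S + \<alpha> S"
proof -
  obtain y :: "'n \<Rightarrow> 'n set \<Rightarrow> 'n set \<Rightarrow> real" where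
    y: "\<And>e S T. 0 \<le> y e S T" "\<And>e S T. y e S T \<noteq> 0 \<Longrightarrow> e \<in> S \<and> S \<subseteq> T"
       "\<And>e S. e \<in> S \<Longrightarrow> \<alpha> S = (\<Sum>R\<in>UNIV. y e R S) - (\<Sum>T\<in>UNIV. y e S T)"
    using valid_inequality_flow[OF valid] by metis
  define out where "out e S = (\<Sum>T\<in>UNIV. y e S T)" for e S
  \<comment> \<open>The sum over all \<open>e\<close> dominates each \<open>out e S\<close>, so the
    padding \<open>a S - out e S\<close> is nonnegative.\<close>
  define a where "a S = (\<Sum>e\<in>UNIV. out e S)" for S
  have out_le: "out e S \<le> a S" for e S
    unfolding a_def by (rule member_le_sum) (auto simp: out_def y(1) intro: sum_nonneg)
  define x where "x e S T = y e S T + (if S = T then if e \<in> S then a S - out e S else 0 else 0)" for e S T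
  show ?thesis
  proof (rule that[of x a])
    show "0 \<le> x e S T" for e S T using y(1)[of e S T] out_le[of e S] by (auto simp: x_def)
    show "e \<in> S \<and> S \<subseteq> T" if "x e S T \<noteq> 0" for e S T
      using that y(2)[of e S T] by (auto simp: x_def split: if_splits)
    show "(\<Sum>T\<in>UNIV. x e S T) = a S" if "e \<in> S" for e S
      using that by (simp add: x_def sum.distrib out_def[symmetric])
    show "(\<Sum>R\<in>UNIV. x e R S) = a S + \<alpha> S" if "e \<in> S" for e S
      using that y(3)[OF that] by (simp add: x_def sum.distrib out_def[symmetric])
  qed
qed

section \<open>Assembling the covers\<close>

text \<open>Row and column sums at \<open>S\<close> do not depend on the element of
  \<open>S\<close>, so they can serve as the multiplicities of \<open>S\<close> in \<open>A\<close>
  and in \<open>B\<close>.\<close>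

lemma transport_imp_covers:
  fixes z :: "'n::finite \<Rightarrow> 'n set \<Rightarrow> 'n set \<Rightarrow> nat"
  assumes supp: "\<And>e S T. z e S T > 0 \<Longrightarrow> e \<in> S \<and> S \<subseteq> T"
    and rows: "\<And>e e' S. e \<in> S \<Longrightarrow> e' \<in> S \<Longrightarrow> (\<Sum>T\<in>UNIV. z e S T) = (\<Sum>T\<in>UNIV. z e' S T)"
    and cols: "\<And>e e' S. e \<in> S \<Longrightarrow> e' \<in> S \<Longrightarrow> (\<Sum>R\<in>UNIV. z e R S) = (\<Sum>R\<in>UNIV. z e' R S)"
  shows "\<exists>A B. covers A B \<and>
    (\<forall>e S. e \<in> S \<longrightarrow> count_list A S = (\<Sum>T\<in>UNIV. z e S T) \<and>
                    count_list B S = (\<Sum>R\<in>UNIV. z e R S))"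
proof -
  define pick where "pick S = (SOME e. e \<in> S)" for S :: "'n set"
  have pick: "pick S \<in> S" if "e \<in> S" for e S
    unfolding pick_def using that by (rule someI)
  \<comment> \<open>The empty set gets multiplicity 0: \<open>pick {}\<close> is arbitrary, and
    covers admit nonempty sets only.\<close>
  obtain A where A: "\<And>S. count_list A S = (if S = {} then 0 else \<Sum>T\<in>UNIV. z (pick S) S T)"
    using list_with_counts[of "\<lambda>S. if S = {} then 0 else \<Sum>T\<in>UNIV. z (pick S) S T"] by metis
  obtain B where B: "\<And>S. count_list B S = (if S = {} then 0 else \<Sum>R\<in>UNIV. z (pick S) R S)"
    using list_with_counts[of "\<lambda>S. if S = {} then 0 else \<Sum>R\<in>UNIV. z (pick S) R S"] by metis
  have cA: "count_list A S = (\<Sum>T\<in>UNIV. z e S T)" if "e \<in> S" for e S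
    using A[of S] rows[OF pick[OF that] that] that by auto
  have cB: "count_list B S = (\<Sum>R\<in>UNIV. z e R S)" if "e \<in> S" for e S
    using B[of S] cols[OF pick[OF that] that] that by auto
  have "covers A B"
  proof (rule coversI_transport)
    show "{} \<notin> set A" "{} \<notin> set B" using A[of "{}"] B[of "{}"] by (simp_all add: count_list_0_iff)
  qed (use supp cA cB in auto)
  then show ?thesis
    by (intro exI[of _ A] exI[of _ B] conjI allI impI) (assumption, erule cA, erule cB)
qed

theorem theorem2:
  fixes \<alpha> :: "'n::finite set \<Rightarrow> real"
  assumes "\<forall>v \<in> (\<Psi> :: ('n set \<Rightarrow> real) set). (\<Sum>S | S \<noteq> {}. \<alpha> S * v S) \<le> 0"
  shows "\<exists>(R::nat) (\<A> :: nat \<Rightarrow> 'n set list) (\<B> :: nat \<Rightarrow> 'n set list) (\<mu> :: nat \<Rightarrow> real).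
           (\<forall>r<R. covers (\<A> r) (\<B> r) \<and> \<mu> r > 0) \<and>
           (\<forall>S. S \<noteq> {} \<longrightarrow>
              \<alpha> S = (\<Sum>r<R. \<mu> r * (real (count_list (\<B> r) S) - real (count_list (\<A> r) S))))"
proof -
  obtain x :: "'n \<Rightarrow> 'n set \<Rightarrow> 'n set \<Rightarrow> real" and a :: "'n set \<Rightarrow> real"
    where x: "\<And>e S T. 0 \<le> x e S T" "\<And>e S T. x e S T \<noteq> 0 \<Longrightarrow> e \<in> S \<and> S \<subseteq> T"
      "\<And>e S. e \<in> S \<Longrightarrow> (\<Sum>T\<in>UNIV. x e S T) = a S"
      "\<And>e S. e \<in> S \<Longrightarrow> (\<Sum>R\<in>UNIV. x e R S) = a S + \<alpha> S"
    using valid_inequality_transport[OF assms] by blast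
  define row where "row e S = range (\<lambda>T :: 'n set. (e, S, T))" for e :: 'n and S :: "'n set"
  define col where "col e S = range (\<lambda>R :: 'n set. (e, R, S))" for e :: 'n and S :: "'n set"
  \<comment> \<open>The equations say that the outflow at \<open>S\<close>, and likewise the inflow,
    is the same for all elements of \<open>S\<close>.\<close>
  define E where "E = {(row e S, row e' S) | e e' S. e \<in> S \<and> e' \<in> S}
    \<union> {(col e S, col e' S) | e e' S. e \<in> S \<and> e' \<in> S}"
  \<comment> \<open>Kept polymorphic, for use with the real \<open>x'\<close> and the natural-valued
    \<open>z r\<close>.\<close>
  have sum_row: "sum f (row e S) = (\<Sum>T\<in>UNIV. f (e, S, T))"
    for f :: "'n \<times> 'n set \<times> 'n set \<Rightarrow> 'b::comm_monoid_add" and e S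
    unfolding row_def by (subst sum.reindex) (auto simp: inj_on_def)
  have sum_col: "sum f (col e S) = (\<Sum>R\<in>UNIV. f (e, R, S))"
    for f :: "'n \<times> 'n set \<times> 'n set \<Rightarrow> 'b::comm_monoid_add" and e S
    unfolding col_def by (subst sum.reindex) (auto simp: inj_on_def)
  define x' where "x' = (\<lambda>(e, S, T). x e S T)"
  have nonneg: "0 \<le> x' p" for p using x(1) by (simp add: x'_def split: prod.split)
  have bal: "sum x' P = sum x' Q" if "(P, Q) \<in> E" for P Q
    using that x(3,4) by (auto simp: E_def sum_row sum_col x'_def)
  obtain R :: nat and \<mu> :: "nat \<Rightarrow> real" and z :: "nat \<Rightarrow> 'n \<times> 'n set \<times> 'n set \<Rightarrow> nat" where
    z: "\<forall>r<R. \<mu> r > 0 \<and> (\<forall>(P, Q)\<in>E. sum (z r) P = sum (z r) Q)"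
    and x'_eq: "\<forall>p. x' p = (\<Sum>r<R. \<mu> r * real (z r p))"
    using balanced_nat_decomposition[of x' E, OF nonneg bal] by blast
  have "\<exists>A B. covers A B \<and>
      (\<forall>e S. e \<in> S \<longrightarrow> count_list A S = (\<Sum>T\<in>UNIV. z r (e, S, T)) \<and>
                      count_list B S = (\<Sum>T\<in>UNIV. z r (e, T, S)))" if "r < R" for r
  proof -
    have supp: "e \<in> S \<and> S \<subseteq> T" if "z r (e, S, T) > 0" for e S T
    proof -
      \<comment> \<open>The summands of \<open>x'\<close> are nonnegative and \<open>\<mu> r\<close>
        is positive, so the support of \<open>z r\<close> lies in that of \<open>x'\<close>.\<close>
      have "0 < \<mu> r * real (z r (e, S, T))" using z \<open>r < R\<close> that by simp
      also have "\<dots> \<le> (\<Sum>r<R. \<mu> r * real (z r (e, S, T)))"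
        using z \<open>r < R\<close> by (intro member_le_sum) (auto simp: less_imp_le)
      also have "\<dots> = x e S T" by (simp add: x'_def flip: x'_eq[rule_format])
      finally show ?thesis using x(2)[of e S T] by simp
    qed
    have balz: "sum (z r) P = sum (z r) Q" if "(P, Q) \<in> E" for P Q
      using z \<open>r < R\<close> that by blast
    have row_eq: "(\<Sum>T\<in>UNIV. z r (e, S, T)) = (\<Sum>T\<in>UNIV. z r (e', S, T))" if "e \<in> S" "e' \<in> S" for e e' S
    proof -
      have "(row e S, row e' S) \<in> E" using that unfolding E_def by blast
      from balz[OF this] show ?thesis by (simp add: sum_row)
    qed
    have col_eq: "(\<Sum>T\<in>UNIV. z r (e, T, S)) = (\<Sum>T\<in>UNIV. z r (e', T, S))" if "e \<in> S" "e' \<in> S" for e e' S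
    proof -
      have "(col e S, col e' S) \<in> E" using that unfolding E_def by blast
      from balz[OF this] show ?thesis by (simp add: sum_col)
    qed
    show ?thesis
      by (rule transport_imp_covers[of "\<lambda>e S T. z r (e, S, T)"]) (rule supp row_eq col_eq; assumption)+
  qed
  then obtain \<A> \<B> where AB: "\<And>r. r < R \<Longrightarrow> covers (\<A> r) (\<B> r)"
    "\<And>r e S. r < R \<Longrightarrow> e \<in> S \<Longrightarrow> count_list (\<A> r) S = (\<Sum>T\<in>UNIV. z r (e, S, T))"
    "\<And>r e S. r < R \<Longrightarrow> e \<in> S \<Longrightarrow> count_list (\<B> r) S = (\<Sum>T\<in>UNIV. z r (e, T, S))"
    by metis
  have \<alpha>_eq: "\<alpha> S = (\<Sum>r<R. \<mu> r * (real (count_list (\<B> r) S) - real (count_list (\<A> r) S)))"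
    if "S \<noteq> {}" for S
  proof -
    from that obtain e where e: "e \<in> S" by blast
    have expand: "(\<Sum>T\<in>UNIV. x' (\<phi> T)) = (\<Sum>r<R. \<mu> r * real (\<Sum>T\<in>UNIV. z r (\<phi> T)))"
      for \<phi> :: "'n set \<Rightarrow> 'n \<times> 'n set \<times> 'n set"
      unfolding x'_eq[rule_format] by (subst sum.swap) (simp add: sum_distrib_left)
    \<comment> \<open>Inflow minus outflow at \<open>S\<close> is \<alpha> at \<open>S\<close> for
      any \<open>e\<close> in \<open>S\<close>; in each integer solution the same difference is a
      difference of multiplicities.\<close>
    have "\<alpha> S = (\<Sum>T\<in>UNIV. x' (e, T, S)) - (\<Sum>T\<in>UNIV. x' (e, S, T))"
      using x(3,4)[OF e] by (simp add: x'_def)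
    also have "\<dots> = (\<Sum>r<R. \<mu> r * (real (\<Sum>T\<in>UNIV. z r (e, T, S)) - real (\<Sum>T\<in>UNIV. z r (e, S, T))))"
      unfolding expand[of "\<lambda>T. (e, T, S)"] expand[of "\<lambda>T. (e, S, T)"]
      by (simp add: right_diff_distrib sum_subtractf)
    also have "\<dots> = (\<Sum>r<R. \<mu> r * (real (count_list (\<B> r) S) - real (count_list (\<A> r) S)))"
      using AB(2,3)[OF _ e] by (intro sum.cong) auto
    finally show ?thesis .
  qed
  show ?thesis
    by (intro exI[of _ R] exI[of _ \<A>] exI[of _ \<B>] exI[of _ \<mu>] conjI allI impI)
       (erule AB(1), use z in blast, erule \<alpha>_eq)
qed

end
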